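(* Let $\Omega_A$ be the irreducible 1-step shift of finite type defined by an irreducible $0,1$ matrix $A$, let $\pi:\Omega_A\to Y$ be a 1-block code onto a subshift $Y$, and let $\mu$ be a (shift-invariant, fully supported) 1-step Markov measure on $\Omega_A$. Let $n$ be the dimension of the reduced stochastic module of $\pi\mu$, and let $m=|\mathcal A(Y)|$ be the cardinality of the alphabet of $Y$. Suppose $n\ge 2$, and let $K=N(2,m,n)$. If $\pi\mu$ is not $K$-step Markov, then $\pi\mu$ is not $k$-step Markov for any $k\geq 1$.
   Context: $\Omega_A$ is the set of two-sided sequences $x$ over the index set of $A$ with $A(x_i,x_{i+1})=1$ for all $i\in\mathbb Z$, with the shift $\sigma$. A 1-block code $\pi$ is a map given by $(\pi x)_i=\pi(x_i)$ for a map $\pi$ on symbols; $\pi\mu$ is the image measure $(\pi\mu)(E)=\mu(\pi^{-1}E)$. A 1-step Markov measure on $\Omega_A$ is given by a stochastic matrix $P$, with the same zero/positive pattern as $A$, and its stationary probability row vector $p$, via $\mu(\{x: x[0,t]=a_0\cdots a_t\})=p(a_0)P(a_0,a_1)\cdots P(a_{t-1},a_t)$. For $k\ge1$, a shift-invariant Borel probability measure $\nu$ on a subshift $Y$ is $k$-step Markov if for all $i\ge 0$, all $j\ge k$ and all $x\in Y$ with the relevant cylinders of positive measure, $$\nu\big(y[0,i]=x[0,i]\,\big|\,y[-j,-1]=x[-j,-1]\big)=\nu\big(y[0,i]=x[0,i]\,\big|\,y[-k,-1]=x[-k,-1]\big).$$ Integers $N(k,m,n)$, for positive integers $m,n$ and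 $1\le k\le n$, are defined recursively by $$N(n,m,n)=1,\qquad N(k,m,n)=\big(1+m^{N(k+1,m,n)}\big)N(k+1,m,n)\quad\text{if }1\le k<n.$$ A stochastic module for a shift-invariant probability measure $\nu$ on a subshift with finite alphabet $S$ is a triple $(l,\{M_a\}_{a\in S},r)$ where, for some real vector space $V$, each $M_a:V\to V$ is linear, $r\in V$, $l\in V^*$ is a linear functional, and for every word $u_1\cdots u_t$ on $S$ the measure of the cylinder $\{y: y[0,t-1]=u_1\cdots u_t\}$ equals $l M_{u_1}M_{u_2}\cdots M_{u_t}r$. It is reduced if (i) $V$ is the smallest subspace containing $r$ and invariant under all $M_a$, and (ii) $l$ annihilates no nonzero subspace of $V$ invariant under all $M_a$. Every $\nu$ has a reduced stochastic module, unique up to isomorphism; it is finite dimensional when $\nu=\pi\mu$ as in the claim. Its dimension is $\dim V$. *)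

theory Defs
  imports "HOL-Probability.Probability"
begin

section \<open>Subshifts\<close>

definition shift :: "(int \<Rightarrow> 'a) \<Rightarrow> int \<Rightarrow> 'a" where
  "shift x = (\<lambda>i. x (i + 1))"

definition alphabet :: "(int \<Rightarrow> 'a) set \<Rightarrow> 'a set" where
  "alphabet Y = (\<Union>y\<in>Y. range y)"

definition shift_topology :: "(int \<Rightarrow> 'a) set \<Rightarrow> (int \<Rightarrow> 'a) topology" where
  "shift_topology Y =
     subtopology (product_topology (\<lambda>_. discrete_topology UNIV) UNIV) Y"

definition subshift :: "(int \<Rightarrow> 'a) set \<Rightarrow> bool" where
  "subshift Y \<longleftrightarrow>
     finite (alphabet Y) \<and> closedin (shift_topology UNIV) Y \<and> shift ` Y = Y"

definition cylinder :: "(int \<Rightarrow> 'a) set \<Rightarrow> 'a list \<Rightarrow> (int \<Rightarrow> 'a) set" where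
  "cylinder Y u = {y \<in> Y. \<forall>i<length u. y (int i) = u ! i}"

definition zero_one_matrix :: "nat ^ 'a ^ 'a \<Rightarrow> bool" where
  "zero_one_matrix A \<longleftrightarrow> (\<forall>i j. A $ i $ j \<in> {0, 1})"

text \<open>The exponent is required to be positive, so that the \<open>1 \<times> 1\<close> zero matrix is not irreducible.\<close>

definition irreducible_matrix :: "nat ^ 'a ^ 'a::finite \<Rightarrow> bool" where
  "irreducible_matrix A \<longleftrightarrow> (\<forall>i j. \<exists>t\<ge>1. (((**) A ^^ t) (mat 1)) $ i $ j > 0)"

definition Omega :: "nat ^ 'a ^ 'a::finite \<Rightarrow> (int \<Rightarrow> 'a) set" where
  "Omega A = {x. \<forall>i. A $ x i $ x (i + 1) = 1}"

definition block_code :: "('a \<Rightarrow> 'b) \<Rightarrow> (int \<Rightarrow> 'a) \<Rightarrow> int \<Rightarrow> 'b" where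
  "block_code \<pi> x = (\<lambda>i. \<pi> (x i))"

section \<open>Measures on subshifts\<close>

definition shift_borel :: "(int \<Rightarrow> 'a) set \<Rightarrow> (int \<Rightarrow> 'a) measure" where
  "shift_borel Y = sigma Y {U. openin (shift_topology Y) U}"

definition invariant_prob :: "(int \<Rightarrow> 'a) set \<Rightarrow> (int \<Rightarrow> 'a) measure \<Rightarrow> bool" where
  "invariant_prob Y \<nu> \<longleftrightarrow>
     prob_space \<nu> \<and> sets \<nu> = sets (shift_borel Y) \<and> distr \<nu> \<nu> shift = \<nu>"

definition fully_supported :: "(int \<Rightarrow> 'a) set \<Rightarrow> (int \<Rightarrow> 'a) measure \<Rightarrow> bool" where
  "fully_supported Y \<nu> \<longleftrightarrow>
     (\<forall>U. openin (shift_topology Y) U \<and> U \<noteq> {} \<longrightarrow> measure \<nu> U > 0)"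

definition stochastic_matrix :: "real ^ 'a ^ 'a::finite \<Rightarrow> bool" where
  "stochastic_matrix P \<longleftrightarrow>
     (\<forall>i j. P $ i $ j \<ge> 0) \<and> (\<forall>i. (\<Sum>j\<in>UNIV. P $ i $ j) = 1)"

definition stationary_vector :: "real ^ 'a ^ 'a::finite \<Rightarrow> real ^ 'a \<Rightarrow> bool" where
  "stationary_vector P p \<longleftrightarrow>
     (\<forall>i. p $ i \<ge> 0) \<and> (\<Sum>i\<in>UNIV. p $ i) = 1 \<and> p v* P = p"

definition one_step_markov_measure ::
    "nat ^ 'a ^ 'a::finite \<Rightarrow> (int \<Rightarrow> 'a) measure \<Rightarrow> bool" where
  "one_step_markov_measure A \<mu> \<longleftrightarrow>
     invariant_prob (Omega A) \<mu> \<and>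
     (\<exists>P p. stochastic_matrix P \<and> (\<forall>i j. P $ i $ j > 0 \<longleftrightarrow> A $ i $ j = 1) \<and>
        stationary_vector P p \<and>
        (\<forall>u. u \<noteq> [] \<longrightarrow> measure \<mu> (cylinder (Omega A) u) =
           p $ hd u * (\<Prod>i<length u - 1. P $ (u ! i) $ (u ! Suc i))))"

text \<open>The image measure, as a measure on the subshift \<open>Y\<close>.\<close>

definition image_measure ::
    "('a \<Rightarrow> 'b) \<Rightarrow> (int \<Rightarrow> 'b) set \<Rightarrow> (int \<Rightarrow> 'a) measure \<Rightarrow> (int \<Rightarrow> 'b) measure" where
  "image_measure \<pi> Y \<mu> = distr \<mu> (shift_borel Y) (block_code \<pi>)"

text \<open>Intended for \<open>k \<ge> 1\<close> and \<open>invariant_prob Y \<nu>\<close>. The relevant cylinders are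
  the two conditioning ones, without which the conditional probabilities are undefined.\<close>

definition k_step_markov :: "nat \<Rightarrow> (int \<Rightarrow> 'a) set \<Rightarrow> (int \<Rightarrow> 'a) measure \<Rightarrow> bool" where
  "k_step_markov k Y \<nu> \<longleftrightarrow>
     (\<forall>i::nat. \<forall>j\<ge>k. \<forall>x\<in>Y.
        \<P>(y in \<nu>. \<forall>s\<in>{- int j..-1}. y s = x s) > 0 \<and>
        \<P>(y in \<nu>. \<forall>s\<in>{- int k..-1}. y s = x s) > 0 \<longrightarrow>
        \<P>(y in \<nu>. (\<forall>s\<in>{0..int i}. y s = x s) \<bar> (\<forall>s\<in>{- int j..-1}. y s = x s)) =
        \<P>(y in \<nu>. (\<forall>s\<in>{0..int i}. y s = x s) \<bar> (\<forall>s\<in>{- int k..-1}. y s = x s)))"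

section \<open>Stochastic modules\<close>

text \<open>The vector space \<open>V\<close> is the whole type \<open>'v\<close>. The word \<open>u\<close> may be empty, which gives
  \<open>l r = 1\<close>; without this normalisation a reduced module would not be unique, not even its
  dimension. The maps \<open>M a\<close> matter only for \<open>a \<in> alphabet Y\<close>.\<close>

definition stochastic_module ::
    "(int \<Rightarrow> 'b) set \<Rightarrow> (int \<Rightarrow> 'b) measure \<Rightarrow>
     ('v::real_vector \<Rightarrow> real) \<Rightarrow> ('b \<Rightarrow> 'v \<Rightarrow> 'v) \<Rightarrow> 'v \<Rightarrow> bool" where
  "stochastic_module Y \<nu> l M r \<longleftrightarrow>
     linear l \<and> (\<forall>a\<in>alphabet Y. linear (M a)) \<and>
     (\<forall>u\<in>lists (alphabet Y). measure \<nu> (cylinder Y u) = l (foldr M u r))"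

definition invariant_subspace ::
    "'b set \<Rightarrow> ('b \<Rightarrow> 'v::real_vector \<Rightarrow> 'v) \<Rightarrow> 'v set \<Rightarrow> bool" where
  "invariant_subspace S M W \<longleftrightarrow> subspace W \<and> (\<forall>a\<in>S. M a ` W \<subseteq> W)"

definition reduced_stochastic_module ::
    "(int \<Rightarrow> 'b) set \<Rightarrow> (int \<Rightarrow> 'b) measure \<Rightarrow>
     ('v::real_vector \<Rightarrow> real) \<Rightarrow> ('b \<Rightarrow> 'v \<Rightarrow> 'v) \<Rightarrow> 'v \<Rightarrow> bool" where
  "reduced_stochastic_module Y \<nu> l M r \<longleftrightarrow>
     stochastic_module Y \<nu> l M r \<and>
     (\<forall>W. invariant_subspace (alphabet Y) M W \<and> r \<in> W \<longrightarrow> W = UNIV) \<and>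
     (\<forall>W. invariant_subspace (alphabet Y) M W \<and> (\<forall>w\<in>W. l w = 0) \<longrightarrow> W = {0})"

section \<open>The bound\<close>

text \<open>Only the values with \<open>1 \<le> k \<le> n\<close> are meaningful; the value \<open>1\<close> for \<open>k > n\<close> is a dummy.\<close>

function N_bound :: "nat \<Rightarrow> nat \<Rightarrow> nat \<Rightarrow> nat" where
  "N_bound k m n =
     (if k < n then (1 + m ^ N_bound (k + 1) m n) * N_bound (k + 1) m n else 1)"
  by pat_completeness auto
termination
  by (relation "Wellfounded.measure (\<lambda>(k, m, n). n - k)") auto

declare N_bound.simps [simp del]

end

theory Submission
  imports Defs
begin

text \<open>
  Write \<open>M u\<close> for the product of the maps \<open>M a\<close> along a word \<open>u\<close>. In a reduced module the
  Markov property becomes a statement about ranks: the measure is \<open>k\<close>-step Markov if and only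
  if \<open>M u\<close> has rank at most one for every word \<open>u\<close> of length \<open>k\<close>. Indeed, the measure of
  \<open>v u w\<close> is \<open>l (M v (M u (M w r)))\<close>, the vectors \<open>M w r\<close> span the space and the functionals
  \<open>l M v\<close> separate its points; so the independence of the future \<open>w\<close> from the remote past
  \<open>v\<close>, given \<open>u\<close>, means that the bilinear pairing that \<open>M u\<close> induces between pasts and
  futures factors through a line. The two directions are \<open>rank_le_1_of_k_step_markov\<close> and
  \<open>k_step_markov_of_rank_le_1\<close>.

  It remains to see that if all words of some length act with rank at most one, then all words of
  length \<open>N_bound 2 m n\<close> do (\<open>dim_range_N_bound\<close>). A long word must repeat a factor, hence
  contains \<open>u z u\<close>. If the rank does not drop from \<open>u\<close> to \<open>u z u\<close>, it never drops along
  \<open>u z u z \<dots> u\<close>, so it is at most one already (\<open>dim_range_le_1_of_return\<close>). Thus every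
  repetition costs one dimension until rank one is reached, and the pigeonhole principle says how
  long a word has to be to force the next repetition. This is the recursion for \<open>N_bound\<close>.
\<close>

section \<open>Ranks of products of linear maps along words\<close>

lemma linear_foldr:
  assumes "vector_space sc" and "\<And>a. a \<in> S \<Longrightarrow> Vector_Spaces.linear sc sc (M a)" and "u \<in> lists S"
  shows "Vector_Spaces.linear sc sc (foldr M u)"
  using assms(3)
proof induction
  case Nil
  show ?case using vector_space.linear_id[OF assms(1)] by (simp add: id_def)
next
  case (Cons a u)
  then show ?case
    using Vector_Spaces.linear_compose[of sc sc "foldr M u" sc "M a"] assms(2) by (simp add: o_def)
qed

text \<open>
  Cut \<open>w\<close> into \<open>1 + card S ^ N\<close> consecutive blocks of length \<open>N\<close>. There are only
  \<open>card S ^ N\<close> words of that length over \<open>S\<close>, so two of the blocks carry the same word. This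
  count is the source of the factor \<open>1 + m ^ N\<close> in the recursion for \<open>N_bound\<close>.
\<close>

lemma repeated_factor:
  assumes "finite S" and w: "w \<in> lists S" and len: "length w = (1 + card S ^ N) * N"
  obtains a u z b where "w = a @ u @ z @ u @ b" and "length u = N"
proof -
  define blk where "blk i = take N (drop (i * N) w)" for i
  have room: "i * N + N \<le> length w" if "i \<le> card S ^ N" for i
    using mult_le_mono1[of "Suc i" "1 + card S ^ N" N] that len by simp
  have sub: "blk ` {.. card S ^ N} \<subseteq> {xs. set xs \<subseteq> S \<and> length xs = N}"
    using w room by (force simp: blk_def in_lists_conv_set dest: in_set_takeD in_set_dropD)
  have "card (blk ` {.. card S ^ N}) \<le> card S ^ N"
    using card_mono[OF finite_lists_length_eq[OF \<open>finite S\<close>] sub] card_lists_length_eq[OF \<open>finite S\<close>]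
    by simp
  then have "\<not> inj_on blk {.. card S ^ N}"
    by (intro pigeonhole) simp
  then obtain i j where ij: "i < j" "j \<le> card S ^ N" "blk i = blk j"
    by (auto simp: inj_on_def) (metis linorder_neqE_nat)
  define z where "z = take ((j - Suc i) * N) (drop (Suc i * N) w)"
  have 1: "w = take (i * N) w @ blk i @ drop (Suc i * N) w"
    by (simp add: blk_def) (metis add.commute append_take_drop_id drop_drop)
  have "(j - Suc i) * N + Suc i * N = j * N"
    using ij(1) by (metis Suc_leI add_mult_distrib le_add_diff_inverse2)
  then have 2: "drop (Suc i * N) w = z @ drop (j * N) w"
    unfolding z_def by (metis append_take_drop_id drop_drop)
  have 3: "drop (j * N) w = blk j @ drop (N + j * N) w"
    by (simp add: blk_def) (metis append_take_drop_id drop_drop)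
  have "w = take (i * N) w @ blk i @ z @ blk i @ drop (N + j * N) w"
    using 1 unfolding 2 3 ij(3) .
  moreover have "length (blk i) = N"
    using room[of i] ij(1,2) by (simp add: blk_def)
  ultimately show thesis by (rule that)
qed

lemma N_bound_pos: "N_bound k m n > 0"
  by (induction k m n rule: N_bound.induct) (subst N_bound.simps, simp)

context finite_dimensional_vector_space
begin

lemma dim_range_factor_le:
  assumes M: "\<And>a. a \<in> S \<Longrightarrow> Vector_Spaces.linear scale scale (M a)"
    and S: "x \<in> lists S" "u \<in> lists S" "y \<in> lists S"
  shows "dim (range (foldr M (x @ u @ y))) \<le> dim (range (foldr M u))"
proof -
  interpret pair: finite_dimensional_vector_space_pair_1 scale Basis scale ..
  have "range (foldr M (x @ u @ y)) \<subseteq> foldr M x ` range (foldr M u)"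
    by auto
  then have "dim (range (foldr M (x @ u @ y))) \<le> dim (foldr M x ` range (foldr M u))"
    by (rule dim_subset)
  also have "\<dots> \<le> dim (range (foldr M u))"
    using S by (intro pair.dim_image_le linear_foldr[where S = S] M vector_space_axioms)
  finally show ?thesis .
qed

text \<open>
  If the rank of \<open>M u\<close> survives the return \<open>u z u\<close>, then the product \<open>M (u z)\<close> maps the
  image of \<open>M u\<close> onto itself, and so do all its powers. That image is therefore
  contained in the images of arbitrarily long products, which are at most lines.
\<close>

lemma dim_range_le_1_of_return:
  assumes M: "\<And>a. a \<in> S \<Longrightarrow> Vector_Spaces.linear scale scale (M a)"
    and collapse: "\<And>u. \<lbrakk>u \<in> lists S; length u = j\<rbrakk> \<Longrightarrow> dim (range (foldr M u)) \<le> 1"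
    and u: "u \<in> lists S" and z: "z \<in> lists S" and ne: "u @ z \<noteq> []"
    and return: "dim (range (foldr M u)) \<le> dim (range (foldr M (u @ z @ u)))"
  shows "dim (range (foldr M u)) \<le> 1"
proof -
  have subsp: "subspace (range (foldr M v))" if "v \<in> lists S" for v
    using linear_foldr[OF vector_space_axioms M that, THEN Vector_Spaces.linear.axioms(3),
        THEN module_hom.subspace_image]
    by simp
  have "range (foldr M (u @ z @ u)) = range (foldr M u)"
    using u z return by (intro subspace_dim_equal subsp) auto
  then have fix1: "foldr M (u @ z) ` range (foldr M u) = range (foldr M u)"
    by (simp add: image_image)
  define v where "v t = concat (replicate t (u @ z))" for t
  have fix_t: "foldr M (v t) ` range (foldr M u) = range (foldr M u)" for t
  proof (induction t)
    case (Suc t)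
    have "foldr M (v (Suc t)) ` range (foldr M u)
        = foldr M (u @ z) ` foldr M (v t) ` range (foldr M u)"
      by (simp add: v_def image_image)
    then show ?case by (simp only: Suc fix1)
  qed (simp add: v_def)
  have "length (v t) = t * length (u @ z)" for t
    by (induction t) (auto simp: v_def)
  with ne have long: "length (v j) \<ge> j"
    by (cases "length (u @ z)") auto
  have v: "v t \<in> lists S" for t
    using u z by (induction t) (auto simp: v_def)
  have init: "take j (v j) \<in> lists S"
    using v[of j] by (auto simp: in_lists_conv_set dest: in_set_takeD)
  have "range (foldr M u) \<subseteq> range (foldr M (v j))"
    using fix_t[of j] by blast
  \<comment> \<open>Images shrink as a word is prolonged to the right, so a prefix of length \<open>j\<close> suffices.\<close>
  also have "\<dots> \<subseteq> range (foldr M (take j (v j)))"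
  proof -
    have "foldr M (v j) x = foldr M (take j (v j)) (foldr M (drop j (v j)) x)" for x
      by (metis append_take_drop_id comp_apply foldr_append)
    then show ?thesis by auto
  qed
  finally have "dim (range (foldr M u)) \<le> dim (range (foldr M (take j (v j))))"
    by (rule dim_subset)
  also have "\<dots> \<le> 1"
    using init long by (intro collapse) simp_all
  finally show ?thesis .
qed

text \<open>
  By descending induction on \<open>k\<close>, starting at the dimension of the space. A single map of full
  rank would be invertible, and so would all its powers be, contrary to the collapse to lines. If
  all words of length \<open>N\<close> have rank at most \<open>k\<close>, a word of length \<open>(1 + card S ^ N) * N\<close> contains
  some factor \<open>u z u\<close> with \<open>u\<close> of length \<open>N\<close>; if the long word had rank \<open>k\<close>, then so would both
  \<open>u\<close> and \<open>u z u\<close>, which is impossible for \<open>k \<ge> 2\<close>: a rank that survives the return is at most one.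
\<close>

lemma dim_range_N_bound:
  assumes "finite S"
    and M: "\<And>a. a \<in> S \<Longrightarrow> Vector_Spaces.linear scale scale (M a)"
    and collapse: "\<And>u. \<lbrakk>u \<in> lists S; length u = j\<rbrakk> \<Longrightarrow> dim (range (foldr M u)) \<le> 1"
    and "2 \<le> k" "k \<le> dimension"
    and "w \<in> lists S" "length w = N_bound k (card S) dimension"
  shows "dim (range (foldr M w)) < k"
  using \<open>k \<le> dimension\<close> \<open>2 \<le> k\<close> \<open>w \<in> lists S\<close> \<open>length w = _\<close>
proof (induction k arbitrary: w rule: inc_induct)
  case base
  have "w \<noteq> []"
    using base N_bound_pos[of dimension "card S" dimension] by auto
  show ?case
  proof (rule ccontr)
    assume "\<not> ?case"
    \<comment> \<open>The invertible case is a rank-preserving return to the empty word.\<close>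
    then have "dim (range (foldr M [])) \<le> dim (range (foldr M ([] @ w @ [])))"
      by (simp add: dim_UNIV dimension_def)
    with base.prems \<open>w \<noteq> []\<close> have "dim (range (foldr M [])) \<le> 1"
      by (intro dim_range_le_1_of_return[of S M j "[]" w] M collapse) auto
    with base.prems show False
      by (simp add: dim_UNIV dimension_def)
  qed
next
  case (step k)
  let ?N = "N_bound (Suc k) (card S) dimension"
  have len: "length w = (1 + card S ^ ?N) * ?N"
    using step.prems(3) step.hyps by (subst (asm) N_bound.simps) simp
  then obtain a u z b where w: "w = a @ u @ z @ u @ b" and u: "length u = ?N"
    using repeated_factor[OF \<open>finite S\<close> step.prems(2)] by blast
  have S: "a \<in> lists S" "u \<in> lists S" "z \<in> lists S" "b \<in> lists S"
    using step.prems(2) by (simp_all add: w)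
  have le_k: "dim (range (foldr M u)) \<le> k"
    using step.IH[of u] S(2) u step.prems(1) by simp
  have w_le: "dim (range (foldr M w)) \<le> dim (range (foldr M (u @ z @ u)))"
    using dim_range_factor_le[where S = S and M = M and x = a and y = b and u = "u @ z @ u", OF M] S
    by (simp add: w)
  show ?case
  proof (rule ccontr)
    assume "\<not> ?case"
    then have ge_k: "k \<le> dim (range (foldr M (u @ z @ u)))"
      using w_le by simp
    have "u \<noteq> []"
      using u N_bound_pos[of "Suc k" "card S" dimension] by auto
    then have "dim (range (foldr M u)) \<le> 1"
      using dim_range_le_1_of_return[OF M collapse S(2,3)] le_k ge_k by simp
    moreover have "k \<le> dim (range (foldr M u))"
      using ge_k S
        dim_range_factor_le[where S = S and M = M and x = "u @ z" and y = "[]" and u = u, OF M]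
      by simp
    ultimately show False
      using step.prems(1) by simp
  qed
qed

end

section \<open>Measurability on subshifts\<close>

lemma topspace_shift_topology [simp]: "topspace (shift_topology Y) = Y"
  by (simp add: shift_topology_def)

lemma space_shift_borel [simp]: "space (shift_borel Y) = Y"
  unfolding shift_borel_def
  by (rule space_measure_of) (use openin_subset in fastforce)

lemma open_in_shift_borel: "openin (shift_topology Y) U \<Longrightarrow> U \<in> sets (shift_borel Y)"
  unfolding shift_borel_def
  by (subst sets_measure_of) (use openin_subset in fastforce)+

lemma continuous_map_coordinate:
  "continuous_map (shift_topology Y) (discrete_topology UNIV) (\<lambda>y. g (y i))"
proof -
  have "continuous_map (shift_topology Y) (discrete_topology UNIV) (\<lambda>y. y i)"
    unfolding shift_topology_def
    by (intro continuous_map_from_subtopology continuous_map_product_projection) simp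
  moreover have "continuous_map (discrete_topology UNIV) (discrete_topology UNIV) g"
    by simp
  ultimately show ?thesis
    using continuous_map_compose[of _ _ "\<lambda>y. y i" _ g] by (simp add: o_def)
qed

lemma measurable_coordinate [measurable]:
  "(\<lambda>y. y i) \<in> shift_borel Y \<rightarrow>\<^sub>M count_space UNIV"
proof (rule measurableI)
  fix B
  have "openin (shift_topology Y) {y \<in> topspace (shift_topology Y). y i \<in> B}"
    by (rule openin_continuous_map_preimage[OF continuous_map_coordinate[of _ "\<lambda>c. c"]]) simp
  then show "(\<lambda>y. y i) -` B \<inter> space (shift_borel Y) \<in> sets (shift_borel Y)"
    by (auto intro!: open_in_shift_borel simp: vimage_def Int_def conj_commute)
qed simp

text \<open>
  Both the shift and the 1-block codes have this form: they move the coordinates and then recode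
  each symbol.
\<close>

lemma measurable_coordinatewise:
  assumes "(\<lambda>y i. g (y (h i))) ` X \<subseteq> Y"
  shows "(\<lambda>y i. g (y (h i))) \<in> shift_borel X \<rightarrow>\<^sub>M shift_borel Y"
  unfolding shift_borel_def[of Y]
proof (rule measurable_measure_of)
  show "{U. openin (shift_topology Y) U} \<subseteq> Pow Y"
    using openin_subset by fastforce
  show "(\<lambda>y i. g (y (h i))) \<in> space (shift_borel X) \<rightarrow> Y"
    using assms by auto
  fix U
  assume "U \<in> {U. openin (shift_topology Y) U}"
  moreover have "continuous_map (shift_topology X) (shift_topology Y) (\<lambda>y i. g (y (h i)))"
    unfolding shift_topology_def[of Y]
    using assms
    by (intro continuous_map_into_subtopology)
      (auto simp: continuous_map_componentwise_UNIV continuous_map_coordinate)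
  ultimately have "openin (shift_topology X)
      {y \<in> topspace (shift_topology X). (\<lambda>i. g (y (h i))) \<in> U}"
    by (intro openin_continuous_map_preimage) simp_all
  then show "(\<lambda>y i. g (y (h i))) -` U \<inter> space (shift_borel X) \<in> sets (shift_borel X)"
    by (auto intro!: open_in_shift_borel simp: vimage_def Int_def conj_commute)
qed

lemma measurable_shift: "shift ` Y \<subseteq> Y \<Longrightarrow> shift \<in> shift_borel Y \<rightarrow>\<^sub>M shift_borel Y"
  using measurable_coordinatewise[of "\<lambda>c. c" "\<lambda>i. i + 1" Y Y] by (simp add: shift_def[abs_def])

lemma measurable_block_code:
  "block_code \<pi> ` X \<subseteq> Y \<Longrightarrow> block_code \<pi> \<in> shift_borel X \<rightarrow>\<^sub>M shift_borel Y"
  using measurable_coordinatewise[of \<pi> "\<lambda>i. i" X Y] by (simp add: block_code_def[abs_def])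

lemma invariant_prob_image_measure:
  assumes inv: "invariant_prob X \<mu>" and X: "shift ` X \<subseteq> X" and Y: "shift ` Y \<subseteq> Y"
    and code: "block_code \<pi> ` X \<subseteq> Y"
  shows "invariant_prob Y (image_measure \<pi> Y \<mu>)"
proof -
  have sets_\<mu>: "sets \<mu> = sets (shift_borel X)"
    using inv by (simp add: invariant_prob_def)
  have shX [measurable]: "shift \<in> \<mu> \<rightarrow>\<^sub>M \<mu>" and
    co [measurable]: "block_code \<pi> \<in> \<mu> \<rightarrow>\<^sub>M shift_borel Y" and
    shY [measurable]: "shift \<in> shift_borel Y \<rightarrow>\<^sub>M shift_borel Y"
    using measurable_shift[OF X] measurable_block_code[OF code] measurable_shift[OF Y]
    by (simp_all only: measurable_cong_sets[OF sets_\<mu> sets_\<mu>]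
        measurable_cong_sets[OF sets_\<mu> refl[of "sets (shift_borel Y)"]])
  have comm: "shift \<circ> block_code \<pi> = block_code \<pi> \<circ> shift"
    by (simp add: fun_eq_iff shift_def block_code_def)
  let ?\<nu> = "image_measure \<pi> Y \<mu>"
  have sets: "sets ?\<nu> = sets (shift_borel Y)"
    by (simp add: image_measure_def)
  have "distr ?\<nu> ?\<nu> shift = distr ?\<nu> (shift_borel Y) shift"
    by (rule distr_cong) (simp_all add: sets)
  also have "\<dots> = distr \<mu> (shift_borel Y) (block_code \<pi> \<circ> shift)"
    by (simp add: image_measure_def distr_distr comm)
  also have "\<dots> = distr (distr \<mu> \<mu> shift) (shift_borel Y) (block_code \<pi>)"
    by (simp add: distr_distr)
  also have "\<dots> = ?\<nu>"
    using inv by (simp add: invariant_prob_def image_measure_def)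
  finally show ?thesis
    using inv sets by (simp add: invariant_prob_def image_measure_def prob_space.prob_space_distr)
qed

section \<open>Blocks at arbitrary positions\<close>

definition block :: "(int \<Rightarrow> 'a) set \<Rightarrow> int \<Rightarrow> 'a list \<Rightarrow> (int \<Rightarrow> 'a) set" where
  "block Y a u = {y \<in> Y. \<forall>i<length u. y (a + int i) = u ! i}"

definition subword :: "(int \<Rightarrow> 'a) \<Rightarrow> int \<Rightarrow> nat \<Rightarrow> 'a list" where
  "subword x a t = map (\<lambda>i. x (a + int i)) [0..<t]"

lemma length_subword [simp]: "length (subword x a t) = t"
  by (simp add: subword_def)

lemma mem_block_iff: "y \<in> block Y a u \<longleftrightarrow> y \<in> Y \<and> subword y a (length u) = u"
  unfolding block_def subword_def list_eq_iff_nth_eq by simp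

lemma subword_append: "subword x a (s + t) = subword x a s @ subword x (a + int s) t"
proof (induction t)
  case (Suc t) then show ?case by (simp add: subword_def add.assoc)
qed (simp add: subword_def)

lemma block_append: "block Y a (u @ w) = block Y a u \<inter> block Y (a + int (length u)) w"
  unfolding mem_block_iff set_eq_iff Int_iff length_append subword_append by simp blast

lemma subword_in_alphabet: "x \<in> Y \<Longrightarrow> subword x a t \<in> lists (alphabet Y)"
  unfolding subword_def alphabet_def in_lists_conv_set set_map by blast

lemma cylinder_eq_block: "cylinder Y u = block Y 0 u"
  by (simp add: cylinder_def block_def)

lemma agree_iff_subword:
  assumes "b = a + int t - 1"
  shows "(\<forall>s\<in>{a..b}. y s = x s) \<longleftrightarrow> subword y a t = subword x a t"
proof
  assume L: "\<forall>s\<in>{a..b}. y s = x s"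
  show "subword y a t = subword x a t"
    using L assms by (auto simp: subword_def)
next
  assume R: "subword y a t = subword x a t"
  show "\<forall>s\<in>{a..b}. y s = x s"
  proof
    fix s assume s: "s \<in> {a..b}"
    then have "nat (s - a) < t" using assms by auto
    then have "subword y a t ! nat (s - a) = subword x a t ! nat (s - a)" using R by simp
    then show "y s = x s"
      using s \<open>nat (s - a) < t\<close> by (simp add: subword_def)
  qed
qed

section \<open>Invariant measures and the Markov property\<close>

locale invariant_measure =
  fixes Y :: "(int \<Rightarrow> 'b) set" and \<nu> :: "(int \<Rightarrow> 'b) measure"
  assumes shift_Y: "shift ` Y \<subseteq> Y" and inv: "invariant_prob Y \<nu>"
begin

abbreviation weight :: "'b list \<Rightarrow> real" where
  "weight u \<equiv> measure \<nu> (cylinder Y u)"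

lemma sets_\<nu> [measurable_cong]: "sets \<nu> = sets (shift_borel Y)"
  using inv by (simp add: invariant_prob_def)

lemma space_\<nu> [simp]: "space \<nu> = Y"
  using sets_eq_imp_space_eq[OF sets_\<nu>] by simp

sublocale prob_space \<nu>
  using inv by (simp add: invariant_prob_def)

lemma block_sets [measurable]: "block Y a u \<in> sets \<nu>"
proof -
  have coord: "{y \<in> space \<nu>. y i = c} \<in> sets \<nu>" for i c
    by measurable
  have "{y \<in> space \<nu>. \<forall>i\<in>{..<length u}. y (a + int i) = u ! i} \<in> sets \<nu>"
    by (rule sets.sets_Collect_finite_All[OF coord finite_lessThan])
  then show ?thesis
    by (simp only: block_def space_\<nu> lessThan_iff Ball_def)
qed

text \<open>
  By invariance the position of a block is irrelevant. In particular the conditioning blocks to the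
  left of the origin, in which the Markov property is phrased, have the same measure as the
  cylinders at the origin, in which stochastic modules are phrased.
\<close>

lemma measure_block: "measure \<nu> (block Y a u) = weight u"
proof -
  have shift_meas: "shift \<in> \<nu> \<rightarrow>\<^sub>M \<nu>"
    using measurable_shift[OF shift_Y] by (simp only: measurable_cong_sets[OF sets_\<nu> sets_\<nu>])
  have step: "measure \<nu> (block Y (a + 1) u) = measure \<nu> (block Y a u)" for a
  proof -
    have "block Y (a + 1) u = shift -` block Y a u \<inter> space \<nu>"
    proof (rule set_eqI)
      fix y :: "int \<Rightarrow> 'b"
      have "shift y (a + int i) = y (a + 1 + int i)" for i
        by (simp add: shift_def ac_simps)
      then show "y \<in> block Y (a + 1) u \<longleftrightarrow> y \<in> shift -` block Y a u \<inter> space \<nu>"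
        using shift_Y by (auto simp: block_def image_subset_iff)
    qed
    then have "measure \<nu> (block Y (a + 1) u) = measure (distr \<nu> \<nu> shift) (block Y a u)"
      by (simp only: measure_distr[OF shift_meas block_sets])
    also have "\<dots> = measure \<nu> (block Y a u)"
      using inv by (simp add: invariant_prob_def)
    finally show ?thesis .
  qed
  show ?thesis
    unfolding cylinder_eq_block
  proof (induction a rule: int_induct[where k = 0])
    case base
    show ?case ..
  next
    case (step1 i)
    then show ?case using step[of i] by simp
  next
    case (step2 i)
    then show ?case using step[of "i - 1"] by simp
  qed
qed

lemma weight_append_le: "weight (u @ w) \<le> weight u" "weight (v @ u) \<le> weight u"
proof -
  show "weight (u @ w) \<le> weight u"
    by (intro finite_measure_mono) (simp_all add: cylinder_eq_block block_append)
  have "weight (v @ u) \<le> measure \<nu> (block Y (int (length v)) u)"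
    by (intro finite_measure_mono) (simp_all add: cylinder_eq_block block_append)
  then show "weight (v @ u) \<le> weight u"
    by (simp only: measure_block)
qed

lemma sum_weight_append:
  assumes "finite (alphabet Y)"
  shows "(\<Sum>w | set w \<subseteq> alphabet Y \<and> length w = t. weight (u @ w)) = weight u"
proof -
  let ?W = "{w. set w \<subseteq> alphabet Y \<and> length w = t}"
  have "y \<in> (\<Union>w\<in>?W. cylinder Y (u @ w))" if "y \<in> cylinder Y u" for y
  proof (rule UN_I)
    show "y \<in> cylinder Y (u @ subword y (int (length u)) t)"
      using that by (simp add: cylinder_eq_block block_append mem_block_iff)
    show "subword y (int (length u)) t \<in> ?W"
      using that subword_in_alphabet[of y Y "int (length u)" t]
      by (simp add: cylinder_eq_block mem_block_iff lists_eq_set)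
  qed
  then have "cylinder Y u = (\<Union>w\<in>?W. cylinder Y (u @ w))"
    by (auto simp: cylinder_eq_block block_append)
  then have "weight u = measure \<nu> (\<Union>w\<in>?W. cylinder Y (u @ w))"
    by (rule arg_cong)
  also have "\<dots> = (\<Sum>w\<in>?W. weight (u @ w))"
  proof (rule finite_measure_finite_Union)
    show "finite ?W"
      using assms by (rule finite_lists_length_eq)
    show "(\<lambda>w. cylinder Y (u @ w)) ` ?W \<subseteq> sets \<nu>"
      by (simp add: cylinder_eq_block image_subset_iff)
    show "disjoint_family_on (\<lambda>w. cylinder Y (u @ w)) ?W"
      unfolding disjoint_family_on_def
    proof (intro ballI impI)
      fix w w' assume "w \<in> ?W" "w' \<in> ?W" "w \<noteq> w'"
      then have "length w = length w'" by simp
      with \<open>w \<noteq> w'\<close> show "cylinder Y (u @ w) \<inter> cylinder Y (u @ w') = {}"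
        unfolding cylinder_eq_block block_append by (auto simp only: mem_block_iff)
    qed
  qed
  finally show ?thesis ..
qed

lemma prob_agree:
  "\<P>(y in \<nu>. \<forall>s\<in>{- int j..-1}. y s = x s) = weight (subword x (- int j) j)"
proof -
  have "{y \<in> space \<nu>. \<forall>s\<in>{- int j..-1}. y s = x s} = block Y (- int j) (subword x (- int j) j)"
    by (auto simp: agree_iff_subword[where t = j] mem_block_iff)
  then show ?thesis by (simp only: measure_block)
qed

lemma cond_prob_agree:
  "\<P>(y in \<nu>. (\<forall>s\<in>{0..int i}. y s = x s) \<bar> (\<forall>s\<in>{- int j..-1}. y s = x s)) =
     weight (subword x (- int j) j @ subword x 0 (Suc i)) / weight (subword x (- int j) j)"
proof -
  have "{y \<in> space \<nu>. (\<forall>s\<in>{0..int i}. y s = x s) \<and> (\<forall>s\<in>{- int j..-1}. y s = x s)} =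
      block Y (- int j) (subword x (- int j) j @ subword x 0 (Suc i))"
    by (auto simp: agree_iff_subword[where t = j] agree_iff_subword[where t = "Suc i"]
        mem_block_iff block_append)
  then show ?thesis by (simp only: cond_prob_def measure_block prob_agree)
qed

lemma k_step_markov_iff:
  "k_step_markov k Y \<nu> \<longleftrightarrow>
     (\<forall>i. \<forall>j\<ge>k. \<forall>x\<in>Y. weight (subword x (- int j) j) > 0 \<and> weight (subword x (- int k) k) > 0 \<longrightarrow>
        weight (subword x (- int j) j @ subword x 0 (Suc i)) / weight (subword x (- int j) j) =
        weight (subword x (- int k) k @ subword x 0 (Suc i)) / weight (subword x (- int k) k))"
  by (simp only: k_step_markov_def prob_agree cond_prob_agree)

text \<open>
  A form of the Markov property without conditional probabilities, valid for all words. The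
  definition speaks only of points of \<open>Y\<close>, so it yields the equation directly only when
  \<open>v u w\<close> has positive weight. Otherwise the left-hand side vanishes, while the right-hand side
  might not. But both sides have the same sum over all words of the length of \<open>w\<close>, and the left
  one never exceeds the right one; so they agree termwise.
\<close>

lemma k_step_markov_weight:
  assumes fin: "finite (alphabet Y)" and markov: "k_step_markov k Y \<nu>" and len: "length u = k"
    and w: "w \<in> lists (alphabet Y)"
  shows "weight (v @ u @ w) * weight u = weight (v @ u) * weight (u @ w)"
proof (cases "weight (v @ u) = 0 \<or> w = []")
  case True
  then show ?thesis
    using weight_append_le(1)[of "v @ u" w] by (auto simp: order_antisym)
next
  case False
  then have vu: "weight (v @ u) > 0"
    by (simp add: zero_less_measure_iff)
  then have u: "weight u > 0"
    using weight_append_le(2)[of v u] by simp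
  let ?p = "\<lambda>w. weight (v @ u @ w) * weight u" and ?q = "\<lambda>w. weight (v @ u) * weight (u @ w)"
  let ?W = "{x. set x \<subseteq> alphabet Y \<and> length x = length w}"
  have eq: "?p w' = ?q w'" if w': "weight (v @ u @ w') > 0" "w' \<in> ?W" for w'
  proof -
    define j where "j = length (v @ u)"
    have "block Y (- int j) ((v @ u) @ w') \<noteq> {}"
      using w'(1) measure_block[of "- int j" "(v @ u) @ w'"] by auto
    then obtain x where x: "x \<in> Y" "subword x (- int j) j = v @ u"
      "subword x 0 (length w') = w'"
      unfolding block_append[of _ _ "v @ u"] by (auto simp: mem_block_iff j_def)
    then have "subword x (- int k) k = u"
      using subword_append[of x "- int j" "length v" k] len by (simp add: j_def)
    moreover obtain i where "length w' = Suc i"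
      using False w'(2) by (cases w) auto
    moreover have "j \<ge> k" by (simp add: j_def len)
    ultimately have "weight (v @ u @ w') / weight (v @ u) = weight (u @ w') / weight u"
      using markov[unfolded k_step_markov_iff, rule_format, of j x i] x vu u by simp
    then show ?thesis
      using vu u by (simp add: field_simps)
  qed
  have le: "?p w' \<le> ?q w'" if "w' \<in> ?W" for w'
    using eq[OF _ that] by (cases "weight (v @ u @ w') > 0") (auto simp: zero_less_measure_iff)
  have "(\<Sum>w'\<in>?W. ?q w' - ?p w') = 0"
    using sum_weight_append[OF fin, where u = "v @ u" and t = "length w"]
      sum_weight_append[OF fin, where u = u and t = "length w"]
    by (simp add: sum_subtractf flip: sum_distrib_left sum_distrib_right)
  then have "\<forall>w'\<in>?W. ?q w' - ?p w' = 0"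
    using finite_lists_length_eq[OF fin] le by (subst (asm) sum_nonneg_eq_0_iff) auto
  then show ?thesis
    using w by (auto simp: lists_eq_set)
qed

end

section \<open>The Markov property as a rank condition\<close>

context invariant_measure
begin

text \<open>
  The vectors \<open>M w r\<close> span the space, so the Markov equations say that the functionals
  \<open>l M v M u\<close>, for varying \<open>v\<close>, are all multiples of \<open>l M u\<close>. Since the functionals
  \<open>l M v\<close> separate points, \<open>M u x\<close> is determined by the single number \<open>l (M u x)\<close>.
\<close>

lemma rank_le_1_of_k_step_markov:
  fixes l :: "'v::real_vector \<Rightarrow> real"
  assumes red: "reduced_stochastic_module Y \<nu> l M r" and fin: "finite (alphabet Y)"
    and markov: "k_step_markov k Y \<nu>" and u: "u \<in> lists (alphabet Y)" "length u = k"
  obtains e where "range (foldr M u) \<subseteq> span {e}"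
proof -
  let ?S = "alphabet Y"
  have M: "linear (M a)" if "a \<in> ?S" for a
    using red that by (simp add: reduced_stochastic_module_def stochastic_module_def)
  have l: "linear l"
    and weight: "\<And>u. u \<in> lists ?S \<Longrightarrow> weight u = l (foldr M u r)"
    and gen: "\<And>W. \<lbrakk>invariant_subspace ?S M W; r \<in> W\<rbrakk> \<Longrightarrow> W = UNIV"
    and sep: "\<And>W. \<lbrakk>invariant_subspace ?S M W; \<And>w. w \<in> W \<Longrightarrow> l w = 0\<rbrakk> \<Longrightarrow> W = {0}"
    using red by (auto simp: reduced_stochastic_module_def stochastic_module_def)
  have lin: "linear (foldr M w)" if "w \<in> lists ?S" for w
    using linear_foldr[OF real_vector.vector_space_axioms, of ?S M w] M that
    by (simp add: linear_def)
  define R where "R = (\<lambda>w. foldr M w r) ` lists ?S"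
  have span_R: "span R = UNIV"
  proof (rule gen)
    have "foldr M [] r \<in> R"
      unfolding R_def by (rule imageI) simp
    then show "r \<in> span R"
      by (simp add: span_base)
    have "M a ` span R \<subseteq> span R" if a: "a \<in> ?S" for a
    proof -
      have "M a (foldr M w r) \<in> R" if "w \<in> lists ?S" for w
        unfolding R_def by (rule image_eqI[of _ _ "a # w"]) (use a that in simp_all)
      then have "M a ` R \<subseteq> R"
      proof (intro image_subsetI)
        fix x assume "x \<in> R"
        then obtain w where "x = foldr M w r" "w \<in> lists ?S"
          unfolding R_def by (rule imageE)
        then show "M a x \<in> R"
          using \<open>\<And>w. w \<in> lists ?S \<Longrightarrow> M a (foldr M w r) \<in> R\<close> by simp
      qed
      then have "M a ` R \<subseteq> span R"
        using span_superset by (rule order_trans)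
      then show ?thesis
        unfolding linear_span_image[OF M[OF a], symmetric]
        by (rule span_minimal) (rule subspace_span)
    qed
    then show "invariant_subspace ?S M (span R)"
      by (simp add: invariant_subspace_def)
  qed
  have proportional: "l (foldr M v (foldr M u x)) * weight u = weight (v @ u) * l (foldr M u x)"
    if v: "v \<in> lists ?S" for v x
  proof -
    have lin_u: "linear (\<lambda>x. l (foldr M u x))"
      using linear_compose[OF lin[OF u(1)] l] unfolding o_def .
    have lin_vu: "linear (\<lambda>x. l (foldr M v (foldr M u x)))"
      using linear_compose[OF lin[OF u(1)] linear_compose[OF lin[OF v] l]] unfolding o_def .
    have lin_left: "linear (\<lambda>x. l (foldr M v (foldr M u x)) * weight u)"
      using linear_compose[OF lin_vu bounded_linear.linear[OF bounded_linear_mult_left]]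
      unfolding o_def .
    have lin_right: "linear (\<lambda>x. weight (v @ u) * l (foldr M u x))"
      using linear_compose[OF lin_u bounded_linear.linear[OF bounded_linear_mult_right]]
      unfolding o_def .
    have on_R: "l (foldr M v (foldr M u x)) * weight u = weight (v @ u) * l (foldr M u x)"
      if x: "x \<in> R" for x
    proof -
      obtain w where w: "x = foldr M w r" "w \<in> lists ?S"
        using x unfolding R_def by (rule imageE)
      have "l (foldr M v (foldr M u x)) = weight (v @ u @ w)" "l (foldr M u x) = weight (u @ w)"
        using u(1) v w by (simp_all add: weight)
      then show ?thesis
        by (simp only: k_step_markov_weight[OF fin markov u(2) w(2)])
    qed
    have "x \<in> span R"
      by (simp only: span_R UNIV_I)
    then show ?thesis
      by (rule linear_eq_on[OF lin_left lin_right _ on_R])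
  qed
  \<comment> \<open>Vectors that all functionals \<open>l M v\<close> annihilate form an invariant subspace.\<close>
  have sep': "y = 0" if "\<And>v. v \<in> lists ?S \<Longrightarrow> l (foldr M v y) = 0" for y
  proof -
    let ?W = "{y. \<forall>v\<in>lists ?S. l (foldr M v y) = 0}"
    have "subspace ?W"
      unfolding subspace_def
      by (intro conjI ballI allI CollectI)
        (simp_all only: mem_Collect_eq linear_0[OF lin] linear_0[OF l]
          linear_add[OF lin] linear_add[OF l] linear_scale[OF lin] linear_scale[OF l] scaleR_zero_right add_0)
    moreover have "M a y \<in> ?W" if a: "a \<in> ?S" and y: "y \<in> ?W" for a y
    proof (rule CollectI, rule ballI)
      fix v assume "v \<in> lists ?S"
      then have "v @ [a] \<in> lists ?S"
        using a by simp
      with y have "l (foldr M (v @ [a]) y) = 0"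
        by (simp only: mem_Collect_eq)
      then show "l (foldr M v (M a y)) = 0"
        by simp
    qed
    ultimately have "invariant_subspace ?S M ?W"
      unfolding invariant_subspace_def by blast
    moreover have "l y = 0" if "y \<in> ?W" for y
    proof -
      have "l (foldr M [] y) = 0"
        using that by (rule CollectE) (erule bspec, rule lists.Nil)
      then show ?thesis by simp
    qed
    ultimately have "?W = {0}" by (rule sep)
    moreover have "y \<in> ?W"
      by (rule CollectI, rule ballI, rule that)
    ultimately show ?thesis
      by (simp only: singleton_iff)
  qed
  show thesis
  proof (cases "weight u = 0")
    case True
    have "foldr M u x = 0" for x
    proof (rule linear_eq_on[OF lin[OF u(1)] linear_zero, where B = R])
      show "x \<in> span R"
        by (simp only: span_R UNIV_I)
      fix x assume "x \<in> R"
      then obtain w where w: "x = foldr M w r" "w \<in> lists ?S"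
        unfolding R_def by (rule imageE)
      show "foldr M u x = 0"
      proof (rule sep')
        fix v assume "v \<in> lists ?S"
        then have "l (foldr M v (foldr M u x)) = weight (v @ u @ w)"
          using w u by (simp add: weight)
        also have "\<dots> = 0"
          using weight_append_le(2)[of v "u @ w"] weight_append_le(1)[of u w] True
          by (simp add: order_antisym)
        finally show "l (foldr M v (foldr M u x)) = 0" .
      qed
    qed
    then show thesis by (intro that[of 0]) auto
  next
    case False
    \<comment> \<open>The vector \<open>M u r\<close>, scaled so that \<open>l e = 1\<close>, spans the image of \<open>M u\<close>.\<close>
    define e where "e = (1 / weight u) *\<^sub>R foldr M u r"
    have "foldr M u x = l (foldr M u x) *\<^sub>R e" for x
    proof -
      have "foldr M u x - l (foldr M u x) *\<^sub>R e = 0"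
      proof (rule sep')
        fix v assume v: "v \<in> lists ?S"
        have "l (foldr M v e) = weight (v @ u) / weight u"
          using v u by (simp add: e_def weight linear_scale[OF lin[OF v]] linear_scale[OF l])
        then show "l (foldr M v (foldr M u x - l (foldr M u x) *\<^sub>R e)) = 0"
          using proportional[OF v, of x] False
          by (simp only: linear_diff[OF lin[OF v]] linear_scale[OF lin[OF v]]
              linear_diff[OF l] linear_scale[OF l]) (simp add: nonzero_eq_divide_eq mult.commute)
      qed
      then show ?thesis by simp
    qed
    then show thesis
      by (intro that[of e] image_subsetI) (metis span_base span_scale singletonI)
  qed
qed

text \<open>
  If \<open>M u y = g y *\<^sub>R e\<close> with scalars \<open>g y\<close>, then \<open>v u w\<close> has weight
  \<open>g (M w r) * l (M v e)\<close>. The past \<open>v\<close> enters only through the second factor, which cancels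
  in the conditional probabilities.
\<close>

lemma k_step_markov_of_rank_le_1:
  fixes l :: "'v::real_vector \<Rightarrow> real"
  assumes mod: "stochastic_module Y \<nu> l M r"
    and rank: "\<And>u. \<lbrakk>u \<in> lists (alphabet Y); length u = k\<rbrakk> \<Longrightarrow> \<exists>e. range (foldr M u) \<subseteq> span {e}"
  shows "k_step_markov k Y \<nu>"
  unfolding k_step_markov_iff
proof (intro allI impI ballI)
  let ?S = "alphabet Y"
  fix i j x
  assume "k \<le> j" and x: "x \<in> Y"
    and pos: "weight (subword x (- int j) j) > 0 \<and> weight (subword x (- int k) k) > 0"
  define u v w where "u = subword x (- int k) k" and "v = subword x (- int j) (j - k)"
    and "w = subword x 0 (Suc i)"
  have vu: "subword x (- int j) j = v @ u"
    using subword_append[of x "- int j" "j - k" k] \<open>k \<le> j\<close> by (simp add: u_def v_def of_nat_diff)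
  have S: "u \<in> lists ?S" "v \<in> lists ?S" "w \<in> lists ?S"
    using x by (simp_all add: u_def v_def w_def subword_in_alphabet del: in_lists_conv_set)
  have M: "linear (M a)" if "a \<in> ?S" for a
    using mod that by (simp add: stochastic_module_def)
  have l: "linear l" and weight: "\<And>u. u \<in> lists ?S \<Longrightarrow> weight u = l (foldr M u r)"
    using mod by (simp_all add: stochastic_module_def)
  have lin: "linear (foldr M v)"
    using linear_foldr[OF real_vector.vector_space_axioms, of ?S M v] M S by (simp add: linear_def)
  obtain e where "range (foldr M u) \<subseteq> span {e}"
    using rank[OF S(1)] by (auto simp: u_def)
  then have "\<forall>y. \<exists>c. foldr M u y = c *\<^sub>R e"
    by (auto simp: span_singleton)
  then obtain g where g: "foldr M u y = g y *\<^sub>R e" for y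
    by metis
  have wu: "weight (u @ z) = g (foldr M z r) * l e"
    "weight (v @ u @ z) = g (foldr M z r) * l (foldr M v e)" if "z \<in> lists ?S" for z
    using S that by (simp_all add: weight g linear_scale[OF l] linear_scale[OF lin])
  have "weight (v @ u @ w) / weight (v @ u) = weight (u @ w) / weight u"
  proof -
    have "g r \<noteq> 0" "l e \<noteq> 0" "l (foldr M v e) \<noteq> 0"
      using pos wu[of "[]"] by (auto simp: vu simp flip: u_def)
    then show ?thesis
      using wu[of "[]"] wu[OF S(3)] by simp
  qed
  then show "weight (subword x (- int j) j @ subword x 0 (Suc i)) / weight (subword x (- int j) j) =
      weight (subword x (- int k) k @ subword x 0 (Suc i)) / weight (subword x (- int k) k)"
    by (simp add: vu flip: u_def w_def)
qed

text \<open>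
  The Markov property of order \<open>k\<close> is thus the condition that words of length \<open>k\<close> act with
  rank at most one, and the rank bound transfers it from any order to the order \<open>N_bound 2 m n\<close>.
\<close>

lemma k_step_markov_N_bound:
  fixes l :: "'v::real_vector \<Rightarrow> real"
  assumes red: "reduced_stochastic_module Y \<nu> l M r" and fin: "finite (alphabet Y)"
    and dim: "dim (UNIV :: 'v set) \<ge> 2" and markov: "k_step_markov k Y \<nu>"
  shows "k_step_markov (N_bound 2 (card (alphabet Y)) (dim (UNIV :: 'v set))) Y \<nu>"
proof -
  let ?S = "alphabet Y"
  have mod: "stochastic_module Y \<nu> l M r"
    using red by (simp add: reduced_stochastic_module_def)
  have M: "Vector_Spaces.linear (*\<^sub>R) (*\<^sub>R) (M a)" if "a \<in> ?S" for a
    using mod that by (simp add: stochastic_module_def flip: linear_def)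
  obtain B :: "'v set"
    where B: "B \<subseteq> UNIV" "independent B" "UNIV \<subseteq> span B" "card B = dim (UNIV :: 'v set)"
    by (rule basis_exists)
  \<comment> \<open>An infinite basis has cardinality \<open>0\<close>, so a positive dimension is an honest one.\<close>
  have "finite B"
    using B(4) dim by (intro card_ge_0_finite) simp
  interpret fd: finite_dimensional_vector_space "(*\<^sub>R) :: real \<Rightarrow> 'v \<Rightarrow> 'v" B
    rewrites "module.dependent (*\<^sub>R) = dependent" and "module.span (*\<^sub>R) = span"
      and "vector_space.dim (*\<^sub>R) = dim"
    using B \<open>finite B\<close> by unfold_locales (auto simp: dependent_raw_def span_raw_def dim_raw_def)
  have dimension: "fd.dimension = dim (UNIV :: 'v set)"
    using B by (simp add: fd.dimension_def)
  show ?thesis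
  proof (rule k_step_markov_of_rank_le_1[OF mod])
    fix u assume u: "u \<in> lists ?S" "length u = N_bound 2 (card ?S) (dim (UNIV :: 'v set))"
    have "dim (range (foldr M v)) \<le> 1" if v: "v \<in> lists ?S" "length v = k" for v
    proof -
      obtain e where "range (foldr M v) \<subseteq> span {e}"
        using rank_le_1_of_k_step_markov[OF red fin markov v] .
      then show ?thesis
        using dim_le_card[of "range (foldr M v)" "{e}"] by simp
    qed
    then have "dim (range (foldr M u)) < 2"
      using u dim dimension
      by (intro fd.dim_range_N_bound[where S = ?S and M = M and j = k and k = 2, OF fin M]) simp_all
    then have "dim (range (foldr M u)) \<le> Suc 0"
      by linarith
    moreover obtain C where C: "C \<subseteq> range (foldr M u)" "independent C"
      "range (foldr M u) \<subseteq> span C" "card C = dim (range (foldr M u))"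
      by (rule basis_exists)
    moreover have "finite C"
      using C(2) by (rule fd.finiteI_independent)
    ultimately have "\<forall>x\<in>C. \<forall>y\<in>C. x = y"
      using C(4) by (simp only: flip: card_le_Suc0_iff_eq)
    then obtain e where "C \<subseteq> {e}"
      by blast
    then show "\<exists>e. range (foldr M u) \<subseteq> span {e}"
      by (intro exI order_trans[OF C(3)] span_mono)
  qed
qed

end

section \<open>The bound on the Markov order\<close>

lemma shift_Omega: "shift ` Omega A \<subseteq> Omega A"
  by (auto simp: shift_def Omega_def)

theorem proposition5p6:
  fixes A :: "nat ^ 'a ^ 'a::finite"
    and \<pi> :: "'a \<Rightarrow> 'b"
    and Y :: "(int \<Rightarrow> 'b) set"
    and \<mu> :: "(int \<Rightarrow> 'a) measure"
    and l :: "'v::real_vector \<Rightarrow> real"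
    and M :: "'b \<Rightarrow> 'v \<Rightarrow> 'v"
    and r :: 'v
    and m n K :: nat
  assumes "zero_one_matrix A" and "irreducible_matrix A"
    and "subshift Y" and "block_code \<pi> ` Omega A = Y"
    and "one_step_markov_measure A \<mu>" and "fully_supported (Omega A) \<mu>"
    and "reduced_stochastic_module Y (image_measure \<pi> Y \<mu>) l M r"
    and "n = dim (UNIV :: 'v set)"
    and "m = card (alphabet Y)"
    and "n \<ge> 2"
    and "K = N_bound 2 m n"
    and "\<not> k_step_markov K Y (image_measure \<pi> Y \<mu>)"
  shows "\<forall>k\<ge>1. \<not> k_step_markov k Y (image_measure \<pi> Y \<mu>)"
proof -
  have shift_Y: "shift ` Y \<subseteq> Y" and fin: "finite (alphabet Y)"
    using assms(3) by (simp_all add: subshift_def)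
  have "invariant_prob (Omega A) \<mu>"
    using assms(5) by (simp add: one_step_markov_measure_def)
  then have "invariant_prob Y (image_measure \<pi> Y \<mu>)"
    using shift_Omega shift_Y equalityD1[OF assms(4)] by (rule invariant_prob_image_measure)
  with shift_Y interpret invariant_measure Y "image_measure \<pi> Y \<mu>"
    by (rule invariant_measure.intro)
  show ?thesis
  proof (intro allI impI notI)
    fix k
    assume "k_step_markov k Y (image_measure \<pi> Y \<mu>)"
    then have "k_step_markov K Y (image_measure \<pi> Y \<mu>)"
      using k_step_markov_N_bound[OF assms(7) fin] assms(8-11) by simp
    with assms(12) show False ..
  qed
qed

end
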